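(* Let $\bar\triangle=\{\Delta_1,\dots,\Delta_n\}$ be a strip of $n$ triangles with vertices $V_1,\dots,V_{n+2}$ and let $\{\bar\triangle,\mathcal A\}$ be an exact problem (i.e. $\mathcal A\subset|\bar\triangle|$ consists of exactly $n+2$ nodes). Let $m\ge0$, $m\ne1$, and $1\le k\le n-m-1$, and assume that the subproblem $\{\bar\triangle_k^{k+m+1},\mathcal A_k^{k+m+1}\}$ is basic of type "$2+1+\cdots+1+2,m/B$". Then the problem $\{\bar\triangle,\mathcal A\}$ is not poised if the subproblem is not poised. In the case when the subproblem is poised, the problem $\{\bar\triangle,\mathcal A\}$ is poised if and only if both of the following reduced problems are exact and poised: $$\Big\{\bar\triangle_1^{k-1},\ \mathcal A_1^{k-1}\cup\{V_k,V_{k+1}\}\Big\},\qquad \Big\{\bar\triangle_{k+m+2}^{n},\ \mathcal A_{k+m+2}^{n}\cup\{V_{k+m+2},V_{k+m+3}\}\Big\}.$$ Here if $k=1$ the first reduced problem is absent (no condition), and if $k=n-m-1$ the second reduced problem is absent (no condition).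
   Context: A strip of triangles: $n\ge1$ and $V_1,\dots,V_{n+2}$ are points in the plane such that the closed triangles $\Delta_i=[V_i,V_{i+1},V_{i+2}]$, $i=1,\dots,n$, are nondegenerate and: $\Delta_i\cap\Delta_{i+1}$ is exactly the common side $[V_{i+1},V_{i+2}]$; $\Delta_i\cap\Delta_{i+2}=\{V_{i+2}\}$; all other pairs of distinct triangles are disjoint. The strip is $\bar\triangle=\{\Delta_1,\dots,\Delta_n\}$ and $|\bar\triangle|=\bigcup_{i=1}^n\Delta_i$. For $1\le i\le j\le n$, $\bar\triangle_i^j=\{\Delta_i,\dots,\Delta_j\}$, itself a strip, $|\bar\triangle_i^j|$ is the union of its triangles, and $\mathcal A_i^j=\mathcal A\cap|\bar\triangle_i^j|$ is the set of all nodes of $\mathcal A$ lying in it. The interior sides of a strip are the common sides of its neighboring triangles. $S(\bar\triangle)$ is the linear space of continuous functions $s:|\bar\triangle|\to\mathbb R$ whose restriction to each $\Delta_i$ is a polynomial of total degree at most $1$ in two variables. For a finite set of (distinct) nodes $\mathcal A=\{A_1,\dots,A_M\}\subset|\bar\triangle|$, the interpolation problem $\{\bar\triangle,\mathcal A\}$ is poised if for all real $c_1,\dots,c_M$ there is exactly one $s\in S(\bar\triangle)$ with $s(A_i)=c_i$ for all $i$. For a strip of $n$ triangles the problem is exact if $\#\mathcal A=n+2$; the same terminology is used for substrips, with $n$ replaced by their number of triangles. A problem is basic of type "$2+1+\cdots+1+2,m/B$" ($m\ge0$ is the number of $1$'s; for $m=0$ it is also called "$2+2/B$") if its strip consists of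 $m+2$ triangles, the first and the last triangle each contain exactly two nodes, each of the other $m$ triangles contains exactly one node, no node lies on an interior side of the strip, and the line passing through the two nodes in each of the first and the last triangles does not intersect the neighboring triangle (of the strip of that problem).
   Formalization: The equivalence (not the first claim) additionally assumes that no node lies in the open segment (V_k,V_{k+1}) if k>1, nor in (V_{k+m+2},V_{k+m+3}) if k<n-m-1; without this it fails, since a reduced problem can have too many nodes although the full problem is poised. *)

theory Defs
  imports "HOL-Analysis.Analysis"
begin

text \<open>
  A strip is given by its vertex sequence; the pair of indices p, q singles out the
  (sub)strip made of the triangles number p, ..., q, so that no reindexing is needed
  for substrips.
\<close>

definition triangle :: "(nat \<Rightarrow> real^2) \<Rightarrow> nat \<Rightarrow> (real^2) set" where
  "triangle V i = convex hull {V i, V (i + 1), V (i + 2)}"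

definition side :: "(nat \<Rightarrow> real^2) \<Rightarrow> nat \<Rightarrow> (real^2) set" where
  "side V i = closed_segment (V i) (V (i + 1))"

definition strip :: "(nat \<Rightarrow> real^2) \<Rightarrow> nat \<Rightarrow> nat \<Rightarrow> bool" where
  "strip V p q \<longleftrightarrow> p \<le> q \<and>
     (\<forall>i\<in>{p..q}. \<not> collinear {V i, V (i + 1), V (i + 2)}) \<and>
     (\<forall>i\<in>{p..q}. i + 1 \<le> q \<longrightarrow> triangle V i \<inter> triangle V (i + 1) = side V (i + 1)) \<and>
     (\<forall>i\<in>{p..q}. i + 2 \<le> q \<longrightarrow> triangle V i \<inter> triangle V (i + 2) = {V (i + 2)}) \<and>
     (\<forall>i\<in>{p..q}. \<forall>j\<in>{p..q}. i + 3 \<le> j \<longrightarrow> triangle V i \<inter> triangle V j = {})"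

definition support :: "(nat \<Rightarrow> real^2) \<Rightarrow> nat \<Rightarrow> nat \<Rightarrow> (real^2) set" where
  "support V p q = (\<Union>i\<in>{p..q}. triangle V i)"

definition nodes_in :: "(nat \<Rightarrow> real^2) \<Rightarrow> nat \<Rightarrow> nat \<Rightarrow> (real^2) set \<Rightarrow> (real^2) set" where
  "nodes_in V p q A = A \<inter> support V p q"

text \<open>
  Functions on the support are represented by extensional total functions, so that
  equality of splines is equality on the support.
\<close>

definition splines :: "(nat \<Rightarrow> real^2) \<Rightarrow> nat \<Rightarrow> nat \<Rightarrow> (real^2 \<Rightarrow> real) set" where
  "splines V p q = {s \<in> extensional (support V p q).
     continuous_on (support V p q) s \<and>
     (\<forall>i\<in>{p..q}. \<exists>a b c. \<forall>x\<in>triangle V i. s x = a + b * x$1 + c * x$2)}"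

definition interp_problem :: "(nat \<Rightarrow> real^2) \<Rightarrow> nat \<Rightarrow> nat \<Rightarrow> (real^2) set \<Rightarrow> bool" where
  "interp_problem V p q A \<longleftrightarrow> strip V p q \<and> finite A \<and> A \<subseteq> support V p q"

definition poised :: "(nat \<Rightarrow> real^2) \<Rightarrow> nat \<Rightarrow> nat \<Rightarrow> (real^2) set \<Rightarrow> bool" where
  "poised V p q A \<longleftrightarrow>
     (\<forall>c :: real^2 \<Rightarrow> real. \<exists>!s. s \<in> splines V p q \<and> (\<forall>x\<in>A. s x = c x))"

definition exact :: "(nat \<Rightarrow> real^2) \<Rightarrow> nat \<Rightarrow> nat \<Rightarrow> (real^2) set \<Rightarrow> bool" where
  "exact V p q A \<longleftrightarrow> card A = card {p..q} + 2"

text \<open>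
  The interior sides here are those of the problem's own strip.  Hence, when p, ..., q
  is part of a longer strip, nodes on the two outer sides \<open>side V p\<close> and \<open>side V (q + 1)\<close>,
  along which the strip is continued, are not excluded by this definition.
\<close>

definition basic_B :: "(nat \<Rightarrow> real^2) \<Rightarrow> nat \<Rightarrow> nat \<Rightarrow> (real^2) set \<Rightarrow> nat \<Rightarrow> bool" where
  "basic_B V p q A m \<longleftrightarrow> interp_problem V p q A \<and> q = p + m + 1 \<and>
     card (A \<inter> triangle V p) = 2 \<and>
     card (A \<inter> triangle V q) = 2 \<and>
     (\<forall>i\<in>{p<..<q}. card (A \<inter> triangle V i) = 1) \<and>
     (\<forall>i\<in>{p..<q}. A \<inter> side V (i + 1) = {}) \<and>
     affine hull (A \<inter> triangle V p) \<inter> triangle V (p + 1) = {} \<and>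
     affine hull (A \<inter> triangle V q) \<inter> triangle V (q - 1) = {}"

end

theory Submission
  imports Defs
begin

text \<open>
  A spline on a strip is determined by its values at the vertices, and these values are free
  parameters (\<open>splines_eqI\<close>, \<open>vertex_interpolation\<close>).  Two things follow.  Splines on adjacent
  parts of a strip fit together, or extend by zero, as soon as the values at the two common vertices
  match.  And the spline space of \<open>n\<close> triangles has dimension \<open>n + 2\<close>, so every poised problem is
  exact, and an exact problem that is solvable for all data is poised
  (\<open>poised_imp_exact\<close>, \<open>exact_solvable_imp_poised\<close>).

  The nodes of a basic problem avoid the interior sides, so they are counted triangle by triangle
  and the problem is exact (\<open>basic_B_imp_exact\<close>).  If the whole problem is poised, then data on the
  substrip can be interpolated by restricting a global spline, so the exact subproblem is poised
  (\<open>poised_exact_substrip\<close>).  This is the first claim, in contrapositive form.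

  If the subproblem is poised, its nodes determine the spline on the middle part, in particular its
  values at the vertices shared with the two outer parts; conversely, suitable data at its nodes
  produce any desired values at these vertices.  To each outer part the middle part therefore acts
  like two additional nodes at the shared vertices, which is what the reduced problems express.
  Nodes lying both in the middle and in an outer part cause no conflict because they can only be
  shared vertices.  The lemmas \<open>poised_reduced\<close> and \<open>poised_glue\<close> give the two directions of the
  equivalence, which \<open>poised_iff_reduced\<close> states for any poised substrip; exactness of the reduced
  problems comes from their poisedness.
\<close>

section \<open>Finite systems of linear equations\<close>

lemma underdetermined_system:
  fixes a :: "'i \<Rightarrow> 'j \<Rightarrow> 'a::field"
  assumes "finite J" "finite I" "card J < card I"
  shows "\<exists>x. (\<exists>i\<in>I. x i \<noteq> 0) \<and> (\<forall>j\<in>J. (\<Sum>i\<in>I. x i * a i j) = 0)"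
  using assms
proof (induction J arbitrary: I a rule: finite_induct)
  case empty
  then obtain i where "i \<in> I" by (metis card.empty ex_in_conv less_irrefl)
  then show ?case by (intro exI[of _ "\<lambda>_. 1"]) auto
next
  case (insert j J)
  show ?case
  proof (cases "\<forall>i\<in>I. a i j = 0")
    case True
    then show ?thesis using insert.IH[of I a] insert by auto
  next
    case False
    then obtain k where k: "k \<in> I" "a k j \<noteq> 0" by auto
    \<comment> \<open>Gaussian elimination with pivot \<open>a k j\<close>.\<close>
    define b where "b i l = a i l - a i j / a k j * a k l" for i l
    have "card J < card (I - {k})" using insert k by auto
    then obtain x where x: "\<exists>i\<in>I - {k}. x i \<noteq> 0"
        "\<forall>l\<in>J. (\<Sum>i\<in>I - {k}. x i * b i l) = 0"
      using insert.IH[of "I - {k}" b] insert.prems by auto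
    define y where "y = x(k := - (\<Sum>i\<in>I - {k}. x i * a i j) / a k j)"
    have y: "(\<Sum>i\<in>I. y i * a i l) = (\<Sum>i\<in>I - {k}. x i * b i l)" for l
    proof -
      have "(\<Sum>i\<in>I. y i * a i l) = y k * a k l + (\<Sum>i\<in>I - {k}. y i * a i l)"
        using k insert.prems by (simp add: sum.remove)
      also have "(\<Sum>i\<in>I - {k}. y i * a i l) = (\<Sum>i\<in>I - {k}. x i * a i l)"
        by (intro sum.cong) (auto simp: y_def)
      also have "y k * a k l = - (\<Sum>i\<in>I - {k}. x i * (a i j / a k j * a k l))"
        by (simp add: y_def sum_distrib_right sum_divide_distrib mult.assoc)
      finally show ?thesis
        by (simp add: b_def right_diff_distrib sum_subtractf)
    qed
    have "b i j = 0" for i using k by (simp add: b_def)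
    then have "\<forall>l\<in>insert j J. (\<Sum>i\<in>I. y i * a i l) = 0" using x y by simp
    moreover have "\<exists>i\<in>I. y i \<noteq> 0" using x by (auto simp: y_def)
    ultimately show ?thesis by blast
  qed
qed

text \<open>If there were more equations than unknowns, some nonzero \<open>y\<close> would be orthogonal to the
  range of the system, and the right-hand side \<open>y\<close> could not be reached.\<close>

lemma solvable_system_card_le:
  fixes a :: "'i \<Rightarrow> 'j \<Rightarrow> real"
  assumes fin: "finite I" "finite J"
    and onto: "\<And>y. \<exists>x. \<forall>j\<in>J. (\<Sum>i\<in>I. x i * a i j) = y j"
  shows "card J \<le> card I"
proof (rule ccontr)
  assume "\<not> card J \<le> card I"
  then obtain y where y: "\<exists>j\<in>J. y j \<noteq> 0" "\<forall>i\<in>I. (\<Sum>j\<in>J. y j * a i j) = 0"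
    using underdetermined_system[of I J "\<lambda>j i. a i j"] fin by auto
  obtain x where x: "\<forall>j\<in>J. (\<Sum>i\<in>I. x i * a i j) = y j" using onto by blast
  have "(\<Sum>j\<in>J. y j * y j) = (\<Sum>j\<in>J. \<Sum>i\<in>I. x i * (y j * a i j))"
  proof (rule sum.cong)
    fix j assume "j \<in> J"
    then have "y j * y j = y j * (\<Sum>i\<in>I. x i * a i j)" using x by simp
    then show "y j * y j = (\<Sum>i\<in>I. x i * (y j * a i j))"
      by (simp add: sum_distrib_left mult_ac)
  qed simp
  also have "\<dots> = (\<Sum>i\<in>I. x i * (\<Sum>j\<in>J. y j * a i j))"
    by (subst sum.swap) (simp add: sum_distrib_left)
  also have "\<dots> = 0" using y by simp
  finally have "\<forall>j\<in>J. y j = 0" using fin by (simp add: sum_nonneg_eq_0_iff)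
  then show False using y by blast
qed

text \<open>Subtracting a multiple of the solution \<open>z\<close> of the homogeneous system makes the coordinate
  number \<open>k\<close> zero, so the range of the system does not need this unknown.\<close>

lemma system_drop_unknown:
  fixes a :: "'i \<Rightarrow> 'j \<Rightarrow> real"
  assumes fin: "finite I" and k: "k \<in> I" "z k \<noteq> 0"
    and z: "\<And>j. j \<in> J \<Longrightarrow> (\<Sum>i\<in>I. z i * a i j) = 0" and j: "j \<in> J"
  shows "(\<Sum>i\<in>I - {k}. (x i - x k / z k * z i) * a i j) = (\<Sum>i\<in>I. x i * a i j)"
proof -
  have "(\<Sum>i\<in>I. (x i - x k / z k * z i) * a i j)
      = (\<Sum>i\<in>I. x i * a i j) - x k / z k * (\<Sum>i\<in>I. z i * a i j)"
    by (simp add: left_diff_distrib sum_subtractf sum_distrib_left mult.assoc)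
  then show ?thesis using k fin z[OF j] by (simp add: sum.remove)
qed

text \<open>Hence, if there were such a \<open>z\<close>, the system would remain solvable with fewer unknowns than
  equations.\<close>

lemma solvable_square_system_injective:
  fixes a :: "'i \<Rightarrow> 'j \<Rightarrow> real"
  assumes fin: "finite I" "finite J" and card: "card I = card J"
    and onto: "\<And>y. \<exists>x. \<forall>j\<in>J. (\<Sum>i\<in>I. x i * a i j) = y j"
    and z: "\<And>j. j \<in> J \<Longrightarrow> (\<Sum>i\<in>I. z i * a i j) = 0"
    and k: "k \<in> I"
  shows "z k = 0"
proof (rule ccontr)
  assume nz: "z k \<noteq> 0"
  have "\<exists>w. \<forall>j\<in>J. (\<Sum>i\<in>I - {k}. w i * a i j) = y j" for y
  proof -
    obtain x where x: "\<forall>j\<in>J. (\<Sum>i\<in>I. x i * a i j) = y j" using onto ..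
    have "(\<Sum>i\<in>I - {k}. (x i - x k / z k * z i) * a i j) = y j" if "j \<in> J" for j
    proof -
      have "(\<Sum>i\<in>I - {k}. (x i - x k / z k * z i) * a i j) = (\<Sum>i\<in>I. x i * a i j)"
        using fin(1) k nz z that by (rule system_drop_unknown)
      also have "\<dots> = y j" using x that ..
      finally show ?thesis .
    qed
    then show ?thesis by (intro exI[of _ "\<lambda>i. x i - x k / z k * z i"] ballI)
  qed
  from solvable_system_card_le[OF finite_Diff[OF fin(1)] fin(2) this]
  have "card J \<le> card (I - {k})" .
  also have "\<dots> < card I" using fin(1) k by (rule card_Diff1_less)
  finally show False using card by simp
qed

section \<open>Polynomials of degree at most one on a triangle\<close>

text \<open>The points where two such polynomials agree form a convex set.  This is applied to the ends of
  a segment and to the vertices of a triangle.\<close>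

lemma affine_eq_on_convex_hull:
  fixes S :: "(real^2) set" and a b c :: real
  assumes eq: "\<And>x. x \<in> S \<Longrightarrow> a + b * x$1 + c * x$2 = a' + b' * x$1 + c' * x$2"
    and x: "x \<in> convex hull S"
  shows "a + b * x$1 + c * x$2 = a' + b' * x$1 + c' * x$2"
proof -
  let ?T = "{x :: real^2. a + b * x$1 + c * x$2 = a' + b' * x$1 + c' * x$2}"
  have "convex ?T"
  proof (rule convexI)
    fix x y :: "real^2" and u v :: real
    assume "x \<in> ?T" "y \<in> ?T" and uv: "u + v = 1"
    then have "u * (a + b * x$1 + c * x$2) + v * (a + b * y$1 + c * y$2)
        = u * (a' + b' * x$1 + c' * x$2) + v * (a' + b' * y$1 + c' * y$2)" by simp
    moreover have "u * (d + e * x$1 + f * x$2) + v * (d + e * y$1 + f * y$2)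
        = d + e * (u *\<^sub>R x + v *\<^sub>R y)$1 + f * (u *\<^sub>R x + v *\<^sub>R y)$2" for d e f
    proof -
      have "u * (d + e * x$1 + f * x$2) + v * (d + e * y$1 + f * y$2)
        = (u + v) * d + e * (u *\<^sub>R x + v *\<^sub>R y)$1 + f * (u *\<^sub>R x + v *\<^sub>R y)$2"
        by (simp add: algebra_simps)
      then show ?thesis using uv by simp
    qed
    ultimately show "u *\<^sub>R x + v *\<^sub>R y \<in> ?T" by simp
  qed
  moreover have "S \<subseteq> ?T" using eq by auto
  ultimately have "convex hull S \<subseteq> ?T" by (rule hull_minimal[rotated])
  then show ?thesis using x by auto
qed

lemma affine_interpolation_triangle:
  fixes P Q R :: "real^2" and u v w :: real
  assumes "\<not> collinear {P, Q, R}"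
  shows "\<exists>a b c. a + b * P$1 + c * P$2 = u \<and> a + b * Q$1 + c * Q$2 = v
    \<and> a + b * R$1 + c * R$2 = w"
proof -
  define p1 p2 r1 r2 where "p1 = P$1 - Q$1" and "p2 = P$2 - Q$2"
    and "r1 = R$1 - Q$1" and "r2 = R$2 - Q$2"
  define D where "D = p1 * r2 - p2 * r1"
  note coords = p1_def[symmetric] p2_def[symmetric] r1_def[symmetric] r2_def[symmetric]
  have D: "D \<noteq> 0"
  proof
    assume D0: "D = 0"
    have nc: "\<not> collinear {0, P - Q, R - Q}"
      using assms collinear_3[of P Q R] by (simp add: NO_MATCH_def)
    then have "P - Q \<noteq> 0" and npar: "\<And>t. R - Q \<noteq> t *\<^sub>R (P - Q)"
      by (auto simp: collinear_lemma)
    then have "p1 \<noteq> 0 \<or> p2 \<noteq> 0"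
      by (auto simp: p1_def p2_def vec_eq_iff forall_2)
    then show False
    proof
      assume "p1 \<noteq> 0"
      then have "R - Q = (r1 / p1) *\<^sub>R (P - Q)"
        using D0 by (simp add: vec_eq_iff forall_2 D_def coords divide_simps mult_ac)
      then show False using npar by blast
    next
      assume "p2 \<noteq> 0"
      then have "R - Q = (r2 / p2) *\<^sub>R (P - Q)"
        using D0 by (simp add: vec_eq_iff forall_2 D_def coords divide_simps mult_ac)
      then show False using npar by blast
    qed
  qed
  \<comment> \<open>Cramer's rule for the gradient.\<close>
  define b c where "b = ((u - v) * r2 - (w - v) * p2) / D"
    and "c = ((w - v) * p1 - (u - v) * r1) / D"
  have "b * p1 + c * p2 = u - v" "b * r1 + c * r2 = w - v"
    using D by (simp_all add: b_def c_def divide_simps) (simp_all add: D_def algebra_simps)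
  then show ?thesis
    by (intro exI[of _ "v - b * Q$1 - c * Q$2"] exI[of _ b] exI[of _ c])
      (simp add: p1_def p2_def r1_def r2_def algebra_simps)
qed

section \<open>Geometry of a strip\<close>

lemma closed_triangle: "closed (triangle V i)"
  unfolding triangle_def by (intro compact_imp_closed compact_convex_hull) auto

lemma triangle_eq_hull: "triangle V i = convex hull (V ` {i..i + 2})"
proof -
  have "{i..i + 2} = {i, i + 1, i + 2}" by auto
  then show ?thesis unfolding triangle_def by (simp only: image_insert image_empty)
qed

lemma vertex_in_triangle: "l \<in> {i..i + 2} \<Longrightarrow> V l \<in> triangle V i"
  unfolding triangle_eq_hull by (intro hull_inc imageI)

lemma vertex_indices_subset: "i \<in> {p..q} \<Longrightarrow> {i..i + 2} \<subseteq> {p..q + 2::nat}"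
  by simp

lemma vertex_pair_subset: "j \<in> {a..b + 1} \<Longrightarrow> {j, j + 1} \<subseteq> {a..b + 2::nat}"
  by simp

lemma vertex_of_triangle_index:
  fixes p q l :: nat
  assumes "p \<le> q" "l \<in> {p..q + 2}"
  obtains i where "i \<in> {p..q}" "l \<in> {i..i + 2}"
proof (cases "l \<le> q")
  case True
  then show ?thesis using that[of l] assms(2) by simp
next
  case False
  then show ?thesis using that[of q] assms by simp
qed

lemma vertex_in_support:
  assumes "p \<le> q" "l \<in> {p..q + 2}"
  shows "V l \<in> support V p q"
  using vertex_of_triangle_index[OF assms] vertex_in_triangle unfolding support_def
  by (metis UN_iff)

lemma affine_eq_on_triangle:
  fixes a b c :: real
  assumes "\<And>l. l \<in> {i..i + 2} \<Longrightarrow>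
      a + b * V l$1 + c * V l$2 = a' + b' * V l$1 + c' * V l$2"
    and x: "x \<in> triangle V i"
  shows "a + b * x$1 + c * x$2 = a' + b' * x$1 + c' * x$2"
  by (rule affine_eq_on_convex_hull[OF _ x[unfolded triangle_eq_hull]]) (use assms(1) in blast)

lemma support_mono: "{a..b} \<subseteq> {p..q} \<Longrightarrow> support V a b \<subseteq> support V p q"
  unfolding support_def by blast

lemma support_Un: "{p..q} = {a..b} \<union> {c..d} \<Longrightarrow> support V p q = support V a b \<union> support V c d"
  unfolding support_def by auto

lemma strip_mono:
  assumes "strip V p q" "p \<le> a" "a \<le> b" "b \<le> q"
  shows "strip V a b"
proof -
  have "{a..b} \<subseteq> {p..q}" using assms(2,4) unfolding atLeastatMost_subset_iff by blast
  moreover have "x \<le> q" if "x \<le> b" for x using that assms(4) by (rule order_trans)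
  ultimately show ?thesis using assms(1,3) unfolding strip_def by blast
qed

lemma triangle_Int_triangle:
  assumes st: "strip V p q" and ij: "i \<in> {p..q}" "j \<in> {p..q}" "i < j"
    and x: "x \<in> triangle V i" "x \<in> triangle V j"
  obtains "j = i + 1" "x \<in> side V (i + 1)" | "j = i + 2" "x = V (i + 2)"
proof -
  have jq: "j \<le> q" using ij(2) unfolding atLeastAtMost_iff ..
  consider "j = i + 1" | "j = i + 2" | "i + 3 \<le> j" using ij(3) by linarith
  then show thesis
  proof cases
    case 1
    then have "triangle V i \<inter> triangle V j = side V (i + 1)"
      using st ij(1) jq unfolding strip_def by blast
    then show thesis using 1 x that(1) by blast
  next
    case 2
    then have "triangle V i \<inter> triangle V j = {V (i + 2)}"
      using st ij(1) jq unfolding strip_def by blast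
    then show thesis using 2 x that(2) by blast
  next
    case 3
    then have "triangle V i \<inter> triangle V j = {}"
      using st ij(1,2) unfolding strip_def by blast
    then show thesis using x by blast
  qed
qed

lemma endpoints_in_side: "V i \<in> side V i" "V (i + 1) \<in> side V i"
  by (simp_all add: side_def)

text \<open>Besides the two triangles next to the cut, which share the common side, only triangles at
  distance two meet across the cut, and they meet in one of the two ends of that side.\<close>

lemma support_Int_support:
  assumes "strip V p q" "p \<le> r" "r < q"
  shows "support V p r \<inter> support V (r + 1) q \<subseteq> side V (r + 1)"
proof
  fix x assume "x \<in> support V p r \<inter> support V (r + 1) q"
  then obtain i j where ij: "i \<in> {p..r}" "j \<in> {r + 1..q}" "x \<in> triangle V i" "x \<in> triangle V j"
    unfolding support_def by blast
  have le: "i \<le> r" "r + 1 \<le> j" using ij(1,2) unfolding atLeastAtMost_iff by blast+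
  have "i \<in> {p..q}" "j \<in> {p..q}" using ij(1,2) assms(2,3) by simp_all
  moreover have "i < j" using le by simp
  ultimately show "x \<in> side V (r + 1)" using ij(3,4)
  proof (rule triangle_Int_triangle[OF assms(1)])
    assume "j = i + 1" and x: "x \<in> side V (i + 1)"
    then have "i = r" using le by simp
    then show ?thesis using x by blast
  next
    assume "j = i + 2" and x: "x = V (i + 2)"
    then have "i + 2 = r + 1 \<or> i + 2 = r + 1 + 1" using le by linarith
    then show ?thesis using x endpoints_in_side[of V "r + 1"] by metis
  qed
qed

section \<open>Splines and vertex values\<close>

lemma splines_agree:
  assumes s: "s \<in> splines V p q" and t: "t \<in> splines V p' q'"
    and sub: "{a..b} \<subseteq> {p..q}" "{a..b} \<subseteq> {p'..q'}"
    and eq: "\<And>l. l \<in> {a..b + 2} \<Longrightarrow> s (V l) = t (V l)"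
    and x: "x \<in> support V a b"
  shows "s x = t x"
proof -
  obtain i where i: "i \<in> {a..b}" "x \<in> triangle V i" using x unfolding support_def by auto
  obtain e f g where st: "\<forall>y\<in>triangle V i. s y = e + f * y$1 + g * y$2"
    using s i sub unfolding splines_def by blast
  obtain e' f' g' where tt: "\<forall>y\<in>triangle V i. t y = e' + f' * y$1 + g' * y$2"
    using t i sub unfolding splines_def by blast
  have "e + f * x$1 + g * x$2 = e' + f' * x$1 + g' * x$2"
  proof (rule affine_eq_on_triangle[OF _ i(2)])
    fix l assume l: "l \<in> {i..i + 2}"
    then have "s (V l) = t (V l)" using eq vertex_indices_subset[OF i(1)] by blast
    then show "e + f * V l$1 + g * V l$2 = e' + f' * V l$1 + g' * V l$2"
      using st tt vertex_in_triangle[OF l] by metis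
  qed
  then show ?thesis using st tt i(2) by metis
qed

lemma splines_eqI:
  assumes "s \<in> splines V p q" "t \<in> splines V p q"
    and "\<And>l. l \<in> {p..q + 2} \<Longrightarrow> s (V l) = t (V l)"
  shows "s = t"
proof (rule extensionalityI)
  show "s \<in> extensional (support V p q)" "t \<in> extensional (support V p q)"
    using assms unfolding splines_def by auto
qed (use splines_agree[OF assms(1,2)] assms(3) in blast)

lemma splines_restrict:
  assumes "s \<in> splines V p q" "{a..b} \<subseteq> {p..q}"
  shows "restrict s (support V a b) \<in> splines V a b"
proof -
  have "continuous_on (support V a b) s"
    using assms support_mono[of a b p q V] unfolding splines_def
    by (blast intro: continuous_on_subset)
  then have "continuous_on (support V a b) (restrict s (support V a b))"
    by (simp cong: continuous_on_cong)
  moreover have "\<exists>e f g. \<forall>x\<in>triangle V i. restrict s (support V a b) x = e + f * x$1 + g * x$2"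
    if i: "i \<in> {a..b}" for i
  proof -
    have "triangle V i \<subseteq> support V a b" using i unfolding support_def by auto
    moreover obtain e f g where "\<forall>x\<in>triangle V i. s x = e + f * x$1 + g * x$2"
      using assms i unfolding splines_def by blast
    ultimately show ?thesis by (metis restrict_apply' subsetD)
  qed
  ultimately show ?thesis unfolding splines_def by auto
qed

text \<open>The values at the vertices are free parameters: the linear interpolants on the single
  triangles agree on common sides and common vertices, because they do so at the vertices, and
  hence they fit together to a continuous function.\<close>

lemma vertex_interpolation:
  assumes st: "strip V p q"
  obtains s where "s \<in> splines V p q" "\<And>l. l \<in> {p..q + 2} \<Longrightarrow> s (V l) = w l"
proof -
  have "\<exists>a b c. \<forall>l\<in>{i..i + 2}. a + b * V l$1 + c * V l$2 = w l" if "i \<in> {p..q}" for i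
  proof -
    have "\<not> collinear {V i, V (i + 1), V (i + 2)}" using st that unfolding strip_def by blast
    from affine_interpolation_triangle[OF this, of "w i" "w (i + 1)" "w (i + 2)"]
    obtain a b c where eqs: "a + b * V i$1 + c * V i$2 = w i"
        "a + b * V (i + 1)$1 + c * V (i + 1)$2 = w (i + 1)"
        "a + b * V (i + 2)$1 + c * V (i + 2)$2 = w (i + 2)" by blast
    have "a + b * V l$1 + c * V l$2 = w l" if "l \<in> {i..i + 2}" for l
    proof -
      have "l = i \<or> l = i + 1 \<or> l = i + 2" using that unfolding atLeastAtMost_iff by linarith
      then show ?thesis using eqs by (elim disjE) (simp_all only:)
    qed
    then show ?thesis by (intro exI[of _ a] exI[of _ b] exI[of _ c] ballI)
  qed
  then obtain a b c where abc:
    "\<And>i l. i \<in> {p..q} \<Longrightarrow> l \<in> {i..i + 2} \<Longrightarrow> a i + b i * V l$1 + c i * V l$2 = w l"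
    by metis
  define f where "f i x = a i + b i * x$1 + c i * x$2" for i :: nat and x :: "real^2"
  have f_vertex: "f i (V l) = w l" if "i \<in> {p..q}" "l \<in> {i..i + 2}" for i l
    unfolding f_def using that by (rule abc)
  have agree_less: "f i x = f j x"
    if ij: "i \<in> {p..q}" "j \<in> {p..q}" "i < j" and x: "x \<in> triangle V i" "x \<in> triangle V j" for i j x
    using triangle_Int_triangle[OF st ij x]
  proof cases
    case 1
    have ends: "f i (V l) = f j (V l)" if "l \<in> {i + 1, i + 2}" for l
    proof -
      have "l \<in> {i..i + 2}" "l \<in> {j..j + 2}" using that unfolding 1(1) by auto
      then show ?thesis using f_vertex ij(1,2) by metis
    qed
    show ?thesis unfolding f_def
    proof (rule affine_eq_on_convex_hull)
      show "x \<in> convex hull {V (i + 1), V (i + 1 + 1)}"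
        using 1(2) unfolding side_def segment_convex_hull .
      fix y assume "y \<in> {V (i + 1), V (i + 1 + 1)}"
      then have "f i y = f j y" using ends by auto
      then show "a i + b i * y$1 + c i * y$2 = a j + b j * y$1 + c j * y$2" unfolding f_def .
    qed
  next
    case 2
    have "i + 2 \<in> {i..i + 2}" "i + 2 \<in> {j..j + 2}" unfolding 2(1) by simp_all
    then show ?thesis unfolding 2(2) using f_vertex ij(1,2) by metis
  qed
  have agree: "f i x = f j x"
    if "i \<in> {p..q}" "j \<in> {p..q}" "x \<in> triangle V i" "x \<in> triangle V j" for i j x
    using agree_less[of i j x] agree_less[of j i x] that by (metis linorder_neq_iff)
  define g where "g x = f (SOME i. i \<in> {p..q} \<and> x \<in> triangle V i) x" for x
  have g: "g x = f i x" if "i \<in> {p..q}" "x \<in> triangle V i" for i x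
  proof -
    have "\<exists>i. i \<in> {p..q} \<and> x \<in> triangle V i" using that by blast
    from someI_ex[OF this] show ?thesis unfolding g_def using agree that by blast
  qed
  define s where "s = restrict g (support V p q)"
  have s: "s x = f i x" if "i \<in> {p..q}" "x \<in> triangle V i" for i x
    using g[OF that] that unfolding s_def support_def by (metis UN_I restrict_apply')
  show thesis
  proof
    have "continuous_on (triangle V i) s" if "i \<in> {p..q}" for i
    proof -
      have "continuous_on (triangle V i) (f i)" unfolding f_def by (intro continuous_intros)
      then show ?thesis using s that by (simp cong: continuous_on_cong)
    qed
    then have "continuous_on (support V p q) s"
      unfolding support_def by (intro continuous_on_closed_Union) (auto simp: closed_triangle)
    then show "s \<in> splines V p q"
      using s unfolding splines_def f_def by (auto simp: s_def)
    fix l assume l: "l \<in> {p..q + 2}"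
    have "p \<le> q" using st by (simp add: strip_def)
    from this l obtain i where "i \<in> {p..q}" "l \<in> {i..i + 2}"
      by (rule vertex_of_triangle_index)
    then show "s (V l) = w l" using s f_vertex vertex_in_triangle by metis
  qed
qed

text \<open>This turns interpolation into a linear system for the vertex values.  The witnesses \<open>h i\<close> are
  the hat functions of the strip, with value one at \<open>V i\<close> and zero at the other vertices.\<close>

lemma spline_expansion:
  assumes st: "strip V p q"
  shows "\<exists>h. \<forall>s\<in>splines V p q. \<forall>x\<in>support V p q.
    s x = (\<Sum>i\<in>{p..q + 2}. s (V i) * h i x)"
proof -
  have "\<exists>t. t \<in> splines V p q \<and> (\<forall>l\<in>{p..q + 2}. t (V l) = (if l = i then 1 else 0))" for i
    using vertex_interpolation[OF st, of "\<lambda>l. if l = i then 1 else 0"] by metis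
  then obtain h where h: "\<And>i. h i \<in> splines V p q"
    "\<And>i l. l \<in> {p..q + 2} \<Longrightarrow> h i (V l) = (if l = i then 1 else 0)" by metis
  show ?thesis
  proof (intro exI[of _ h] ballI)
    fix s x assume s: "s \<in> splines V p q" and "x \<in> support V p q"
    then obtain j where j: "j \<in> {p..q}" "x \<in> triangle V j" unfolding support_def by auto
    obtain a b c where sj: "\<forall>y\<in>triangle V j. s y = a + b * y$1 + c * y$2"
      using s j unfolding splines_def by blast
    have "\<exists>d e f. \<forall>y\<in>triangle V j. h i y = d + e * y$1 + f * y$2" for i
      using h(1)[of i] j unfolding splines_def by blast
    then obtain d e f where hj: "\<And>i y. y \<in> triangle V j \<Longrightarrow> h i y = d i + e i * y$1 + f i * y$2"
      by metis
    let ?I = "{p..q + 2}"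
    let ?S = "\<lambda>u. \<Sum>i\<in>?I. s (V i) * u i"
    have sum: "?S (\<lambda>i. h i y) = ?S d + ?S e * y$1 + ?S f * y$2" if "y \<in> triangle V j" for y
      using hj[OF that]
      by (simp only: distrib_left sum.distrib sum_distrib_right mult.assoc)
    have "a + b * x$1 + c * x$2 = ?S d + ?S e * x$1 + ?S f * x$2"
    proof (rule affine_eq_on_triangle[OF _ j(2)])
      fix l assume l: "l \<in> {j..j + 2}"
      have lI: "l \<in> ?I" using l vertex_indices_subset[OF j(1)] by blast
      have "?S (\<lambda>i. h i (V l)) = (\<Sum>i\<in>?I. if l = i then s (V i) else 0)"
        unfolding h(2)[OF lI] by (intro sum.cong) simp_all
      also have "\<dots> = s (V l)" using lI unfolding sum.delta'[OF finite_atLeastAtMost] by simp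
      finally show "a + b * V l$1 + c * V l$2 = ?S d + ?S e * V l$1 + ?S f * V l$2"
        using sum[OF vertex_in_triangle[OF l]] sj vertex_in_triangle[OF l] by metis
    qed
    then show "s x = ?S (\<lambda>i. h i x)" using sum[OF j(2)] sj j(2) by metis
  qed
qed

section \<open>Poised problems\<close>

lemma poised_iff:
  "poised V p q A \<longleftrightarrow> (\<forall>c. \<exists>s\<in>splines V p q. \<forall>x\<in>A. s x = c x) \<and>
    (\<forall>s\<in>splines V p q. \<forall>t\<in>splines V p q. (\<forall>x\<in>A. s x = t x) \<longrightarrow> s = t)"
  (is "_ \<longleftrightarrow> ?ex \<and> ?un")
proof
  assume po: "poised V p q A"
  have "s = t" if "s \<in> splines V p q" "t \<in> splines V p q" "\<forall>x\<in>A. s x = t x" for s t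
    using po[unfolded poised_def, rule_format, of t] that by blast
  moreover have ?ex using po unfolding poised_def by blast
  ultimately show "?ex \<and> ?un" by blast
next
  assume eu: "?ex \<and> ?un"
  show "poised V p q A"
    unfolding poised_def
  proof
    fix c
    obtain s where "s \<in> splines V p q" "\<forall>x\<in>A. s x = c x" using eu by blast
    then show "\<exists>!s. s \<in> splines V p q \<and> (\<forall>x\<in>A. s x = c x)"
      using eu by (intro ex1I[of _ s]) auto
  qed
qed

text \<open>The splines on \<open>q + 1 - p\<close> triangles form a space of dimension \<open>q + 3 - p\<close>, with the values
  at the \<open>q + 3 - p\<close> vertices as coordinates, so a poised problem has that many nodes.\<close>

lemma poised_imp_exact:
  assumes ip: "interp_problem V p q A" and po: "poised V p q A"
  shows "exact V p q A"
proof -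
  have st: "strip V p q" and fin: "finite A" and sub: "A \<subseteq> support V p q"
    using ip unfolding interp_problem_def by auto
  from spline_expansion[OF st] obtain h where h: "\<forall>s\<in>splines V p q. \<forall>x\<in>support V p q.
    s x = (\<Sum>i\<in>{p..q + 2}. s (V i) * h i x)" ..
  have "card A \<le> card {p..q + 2}"
  proof (rule solvable_system_card_le[where a = h])
    fix c obtain s where s: "s \<in> splines V p q" "\<forall>x\<in>A. s x = c x"
      using po unfolding poised_iff by blast
    have "(\<Sum>i\<in>{p..q + 2}. s (V i) * h i x) = c x" if "x \<in> A" for x
      using h[rule_format, OF s(1) subsetD[OF sub that]] s(2) that by simp
    then show "\<exists>w. \<forall>x\<in>A. (\<Sum>i\<in>{p..q + 2}. w i * h i x) = c x"
      by (intro exI[of _ "\<lambda>i. s (V i)"] ballI)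
  qed (use fin in auto)
  moreover have "\<not> card A < card {p..q + 2}"
  proof
    assume "card A < card {p..q + 2}"
    then obtain w where w: "\<exists>i\<in>{p..q + 2}. w i \<noteq> 0"
      "\<forall>x\<in>A. (\<Sum>i\<in>{p..q + 2}. w i * h i x) = 0"
      using underdetermined_system[of A "{p..q + 2}" h] fin by auto
    obtain s where s: "s \<in> splines V p q" "\<And>l. l \<in> {p..q + 2} \<Longrightarrow> s (V l) = w l"
      using vertex_interpolation[OF st] by metis
    obtain z where z: "z \<in> splines V p q" "\<And>l. l \<in> {p..q + 2} \<Longrightarrow> z (V l) = 0"
      using vertex_interpolation[OF st, of "\<lambda>_. 0"] by metis
    have "s x = z x" if "x \<in> A" for x
      using h[rule_format, OF s(1) subsetD[OF sub that]]
        h[rule_format, OF z(1) subsetD[OF sub that]] s(2) z(2) w(2) that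
      by simp
    then have "s = z" using po s z unfolding poised_iff by blast
    then show False using w(1) s z by auto
  qed
  moreover have "p \<le> q" using st by (simp add: strip_def)
  ultimately show ?thesis unfolding exact_def by (simp add: Suc_diff_le)
qed

text \<open>In the vertex values, interpolation is a square linear system, which is injective once it is
  solvable for all data.\<close>

lemma exact_solvable_imp_poised:
  assumes ip: "interp_problem V p q A" and ex: "exact V p q A"
    and solv: "\<And>c. \<exists>s\<in>splines V p q. \<forall>x\<in>A. s x = c x"
  shows "poised V p q A"
proof -
  have st: "strip V p q" and fin: "finite A" and sub: "A \<subseteq> support V p q"
    using ip unfolding interp_problem_def by auto
  have "p \<le> q" using st by (simp add: strip_def)
  then have card: "card {p..q + 2} = card A" using ex unfolding exact_def by (simp add: Suc_diff_le)
  from spline_expansion[OF st] obtain h where h: "\<forall>s\<in>splines V p q. \<forall>x\<in>support V p q.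
    s x = (\<Sum>i\<in>{p..q + 2}. s (V i) * h i x)" ..
  have onto: "\<exists>w. \<forall>x\<in>A. (\<Sum>i\<in>{p..q + 2}. w i * h i x) = c x" for c
  proof -
    obtain s where s: "s \<in> splines V p q" "\<forall>x\<in>A. s x = c x" using solv by blast
    have "(\<Sum>i\<in>{p..q + 2}. s (V i) * h i x) = c x" if "x \<in> A" for x
      using h[rule_format, OF s(1) subsetD[OF sub that]] s(2) that by simp
    then show ?thesis by (intro exI[of _ "\<lambda>i. s (V i)"] ballI)
  qed
  have "s = t" if s: "s \<in> splines V p q" and t: "t \<in> splines V p q" and eq: "\<forall>x\<in>A. s x = t x" for s t
  proof (rule splines_eqI[OF s t])
    fix l assume "l \<in> {p..q + 2}"
    moreover have "(\<Sum>i\<in>{p..q + 2}. (s (V i) - t (V i)) * h i x) = 0" if "x \<in> A" for x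
      using h[rule_format, OF s subsetD[OF sub that]] h[rule_format, OF t subsetD[OF sub that]]
        eq that by (simp add: left_diff_distrib sum_subtractf)
    ultimately have "s (V l) - t (V l) = 0"
      using solvable_square_system_injective[OF finite_atLeastAtMost fin card onto,
          of "\<lambda>i. s (V i) - t (V i)"] by blast
    then show "s (V l) = t (V l)" by simp
  qed
  then show ?thesis using solv unfolding poised_iff by blast
qed

text \<open>The two larger strips may differ, so that a global spline can be compared with a spline on the
  substrip itself.\<close>

lemma poised_agree:
  assumes po: "poised V a b B" and B: "B \<subseteq> support V a b"
    and s: "s \<in> splines V p q" "{a..b} \<subseteq> {p..q}"
    and t: "t \<in> splines V p' q'" "{a..b} \<subseteq> {p'..q'}"
    and eq: "\<And>x. x \<in> B \<Longrightarrow> s x = t x" and x: "x \<in> support V a b"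
  shows "s x = t x"
proof -
  have "restrict s (support V a b) = restrict t (support V a b)"
  proof -
    have "\<forall>x\<in>B. restrict s (support V a b) x = restrict t (support V a b) x"
      using eq B by auto
    then show ?thesis
      using po splines_restrict[OF s] splines_restrict[OF t] unfolding poised_iff by blast
  qed
  then show ?thesis using x by (metis restrict_apply')
qed

text \<open>The data at the nodes of a substrip extend to data at all nodes, so interpolation in the
  substrip remains solvable; since the number of nodes there is right, it is also unique.\<close>

lemma poised_exact_substrip:
  assumes ip: "interp_problem V P Q A" and po: "poised V P Q A"
    and sub: "P \<le> p" "p \<le> q" "q \<le> Q"
    and ex: "exact V p q (nodes_in V p q A)"
  shows "poised V p q (nodes_in V p q A)"
proof (rule exact_solvable_imp_poised[OF _ ex])
  show "interp_problem V p q (nodes_in V p q A)"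
    using ip strip_mono[of V P Q p q] sub unfolding interp_problem_def nodes_in_def by auto
  fix c obtain s where s: "s \<in> splines V P Q" "\<forall>x\<in>A. s x = c x"
    using po unfolding poised_iff by blast
  have "restrict s (support V p q) \<in> splines V p q" using splines_restrict s sub by auto
  then show "\<exists>s\<in>splines V p q. \<forall>x\<in>nodes_in V p q A. s x = c x"
    using s unfolding nodes_in_def by (intro bexI[of _ "restrict s (support V p q)"]) auto
qed

section \<open>Splitting off a poised subproblem\<close>

text \<open>Here \<open>k..q\<close> is a poised core and \<open>a..b\<close> a part of the strip beside it, the two sharing the
  vertices number \<open>j\<close> and \<open>j + 1\<close>.

  Existence: choose a spline on the core with the prescribed values at the two shared vertices, and
  require the global interpolant to follow it at the nodes of the core.  By poisedness of the core,
  the interpolant then follows it on the whole core, and so it takes the prescribed values at the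
  shared vertices.  A node common to the core and the adjacent part is one of these vertices, so
  following the core spline there respects the prescribed data.

  Uniqueness: the difference of two solutions vanishes at the shared vertices.  The assumption
  \<open>shared\<close> says that the other triangles have at most these vertices in common with the part
  \<open>a..b\<close>, hence the extension of the difference by zero at all remaining vertices is zero on those
  triangles.  It is a global spline that vanishes at all nodes.\<close>

lemma poised_reduced:
  assumes ip: "interp_problem V P Q A" and po: "poised V P Q A"
    and ab: "a \<le> b" "{a..b} \<subseteq> {P..Q}" and kq: "k \<le> q" "{k..q} \<subseteq> {P..Q}"
    and j: "j \<in> {a..b + 1}" "j \<in> {k..q + 1}"
    and shared: "\<And>i. i \<in> {P..Q} - {a..b} \<Longrightarrow> {i..i + 2} \<inter> {a..b + 2} \<subseteq> {j, j + 1}"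
    and cut: "A \<inter> support V a b \<inter> support V k q \<subseteq> {V j, V (j + 1)}"
    and core: "poised V k q (nodes_in V k q A)"
  shows "poised V a b (nodes_in V a b A \<union> {V j, V (j + 1)})"
proof -
  let ?B = "nodes_in V a b A \<union> {V j, V (j + 1)}"
  have st: "strip V P Q" and A: "A \<subseteq> support V P Q"
    using ip unfolding interp_problem_def by auto
  have stk: "strip V k q" using strip_mono[OF st] kq by auto
  have jk: "V j \<in> support V k q" "V (j + 1) \<in> support V k q"
    using vertex_in_support[OF kq(1)] vertex_pair_subset[OF j(2)] by blast+
  have ja: "V j \<in> support V a b" "V (j + 1) \<in> support V a b"
    using vertex_in_support[OF ab(1)] vertex_pair_subset[OF j(1)] by blast+
  have "\<exists>s\<in>splines V a b. \<forall>x\<in>?B. s x = d x" for d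
  proof -
    obtain r where r: "r \<in> splines V k q" "\<And>l. l \<in> {k..q + 2} \<Longrightarrow> r (V l) = d (V l)"
      using vertex_interpolation[OF stk, of "\<lambda>l. d (V l)"] by metis
    have rj: "r (V j) = d (V j)" "r (V (j + 1)) = d (V (j + 1))"
      using r(2) vertex_pair_subset[OF j(2)] by blast+
    obtain s where s: "s \<in> splines V P Q"
      "\<forall>x\<in>A. s x = (if x \<in> support V k q then r x else d x)"
      using po[unfolded poised_iff, THEN conjunct1, rule_format,
          of "\<lambda>x. if x \<in> support V k q then r x else d x"] by blast
    have sr: "s x = r x" if "x \<in> support V k q" for x
    proof (rule poised_agree[OF core _ s(1) kq(2) r(1) order_refl _ that])
      show "nodes_in V k q A \<subseteq> support V k q" unfolding nodes_in_def by blast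
      show "s y = r y" if "y \<in> nodes_in V k q A" for y
        using s(2) that unfolding nodes_in_def by simp
    qed
    have s_d: "s x = d x" if "x \<in> ?B" for x
    proof (cases "x \<in> {V j, V (j + 1)}")
      case True
      then show ?thesis using sr jk rj by auto
    next
      case False
      then have "x \<in> A" "x \<in> support V a b" "x \<notin> support V k q"
        using that cut by (auto simp: nodes_in_def)
      then show ?thesis using s(2) by auto
    qed
    have "?B \<subseteq> support V a b" using ja by (auto simp: nodes_in_def)
    from subsetD[OF this] s_d have "restrict s (support V a b) x = d x" if "x \<in> ?B" for x
      using that by (metis restrict_apply')
    then show ?thesis using splines_restrict[OF s(1) ab(2)] by blast
  qed
  moreover have "s = t"
    if s: "s \<in> splines V a b" and t: "t \<in> splines V a b" and eq: "\<forall>x\<in>?B. s x = t x" for s t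
  proof -
    \<comment> \<open>\<open>E f\<close> extends \<open>f\<close> by the value zero at all vertices outside the part \<open>a..b\<close>.\<close>
    have "\<exists>u\<in>splines V P Q. \<forall>l\<in>{P..Q + 2}. u (V l) = (if l \<in> {a..b + 2} then f (V l) else 0)"
      for f :: "real^2 \<Rightarrow> real"
      using vertex_interpolation[OF st, of "\<lambda>l. if l \<in> {a..b + 2} then f (V l) else 0"] by metis
    then obtain E where E: "\<And>f. E f \<in> splines V P Q"
      "\<And>f l. l \<in> {P..Q + 2} \<Longrightarrow> E f (V l) = (if l \<in> {a..b + 2} then f (V l) else (0 :: real))"
      by metis
    have sub2: "{a..b + 2} \<subseteq> {P..Q + 2}" using ab by simp
    have inside: "E f x = f x" if "f \<in> splines V a b" "x \<in> support V a b" for f x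
    proof (rule splines_agree[OF E(1) that(1) ab(2) order_refl _ that(2)])
      fix l assume l: "l \<in> {a..b + 2}"
      then show "E f (V l) = f (V l)" unfolding E(2)[OF subsetD[OF sub2 l]] by (rule if_P)
    qed
    have outside: "E s x = E t x" if i: "i \<in> {P..Q} - {a..b}" "x \<in> triangle V i" for i x
    proof (rule splines_agree[OF E(1) E(1)])
      show "{i..i} \<subseteq> {P..Q}" "{i..i} \<subseteq> {P..Q}"
        using i(1) unfolding atLeastAtMost_singleton by blast+
      show "x \<in> support V i i" using i(2) unfolding support_def atLeastAtMost_singleton by blast
      fix l assume l: "l \<in> {i..i + 2}"
      have lPQ: "l \<in> {P..Q + 2}" using l vertex_indices_subset[of i P Q] i(1) by blast
      have "s (V l) = t (V l)" if "l \<in> {a..b + 2}"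
        using shared[OF i(1)] l that eq by blast
      then show "E s (V l) = E t (V l)" unfolding E(2)[OF lPQ] by (rule if_cong[OF refl _ refl])
    qed
    have "E s x = E t x" if "x \<in> A" for x
    proof (cases "x \<in> support V a b")
      case True
      then show ?thesis using inside[OF s] inside[OF t] eq that by (simp add: nodes_in_def)
    next
      case False
      moreover obtain i where "i \<in> {P..Q}" "x \<in> triangle V i"
        using A \<open>x \<in> A\<close> unfolding support_def by blast
      ultimately show ?thesis using outside[of i x] unfolding support_def by blast
    qed
    then have "E s = E t" using po E(1) unfolding poised_iff by blast
    then have "s (V l) = t (V l)" if "l \<in> {a..b + 2}" for l
      using inside[OF s] inside[OF t] vertex_in_support[OF ab(1) that] \<open>E s = E t\<close> by metis
    then show ?thesis by (rule splines_eqI[OF s t])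
  qed
  ultimately show ?thesis unfolding poised_iff by blast
qed

text \<open>In the other direction, the core is interpolated first; its values at the shared vertices,
  together with the given data, then determine the spline on the adjacent part.\<close>

lemma poised_glue:
  assumes st: "strip V P Q" and PQ: "{P..Q} = {k..q} \<union> {a..b}"
    and ab: "a \<le> b" and kq: "k \<le> q"
    and j: "j \<in> {a..b + 1}" "j \<in> {k..q + 1}"
    and shared: "{k..q + 2} \<inter> {a..b + 2} \<subseteq> {j, j + 1}"
    and core: "poised V k q (nodes_in V k q A)"
    and reduced: "poised V a b (nodes_in V a b A \<union> {V j, V (j + 1)})"
  shows "poised V P Q (nodes_in V P Q A)"
proof -
  let ?B = "nodes_in V a b A \<union> {V j, V (j + 1)}"
  have supp: "support V P Q = support V k q \<union> support V a b" using support_Un[OF PQ] .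
  have sub: "{k..q} \<subseteq> {P..Q}" "{a..b} \<subseteq> {P..Q}" unfolding PQ by blast+
  then have sub2: "{k..q + 2} \<subseteq> {P..Q + 2}" "{a..b + 2} \<subseteq> {P..Q + 2}"
    using ab kq by simp_all
  have jk: "V j \<in> support V k q" "V (j + 1) \<in> support V k q"
    using vertex_in_support[OF kq] vertex_pair_subset[OF j(2)] by blast+
  have ja: "V j \<in> support V a b" "V (j + 1) \<in> support V a b"
    using vertex_in_support[OF ab] vertex_pair_subset[OF j(1)] by blast+
  have core_sub: "nodes_in V k q A \<subseteq> support V k q" and B_sub: "?B \<subseteq> support V a b"
    using ja by (auto simp: nodes_in_def)
  have "\<exists>s\<in>splines V P Q. \<forall>x\<in>nodes_in V P Q A. s x = c x" for c
  proof -
    obtain r where r: "r \<in> splines V k q" "\<forall>x\<in>nodes_in V k q A. r x = c x"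
      using core unfolding poised_iff by blast
    define d where "d x = (if x \<in> {V j, V (j + 1)} then r x else c x)" for x
    obtain t where t: "t \<in> splines V a b" "\<forall>x\<in>?B. t x = d x"
      using reduced unfolding poised_iff by blast
    have rt: "r (V l) = t (V l)" if "l \<in> {j, j + 1}" for l using t(2) that by (auto simp: d_def)
    obtain s where s: "s \<in> splines V P Q"
      "\<And>l. l \<in> {P..Q + 2} \<Longrightarrow> s (V l) = (if l \<in> {k..q + 2} then r (V l) else t (V l))"
      using vertex_interpolation[OF st,
          of "\<lambda>l. if l \<in> {k..q + 2} then r (V l) else t (V l)"] by metis
    have sr: "s x = r x" if "x \<in> support V k q" for x
    proof (rule splines_agree[OF s(1) r(1) sub(1) order_refl _ that])
      fix l assume l: "l \<in> {k..q + 2}"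
      then show "s (V l) = r (V l)" unfolding s(2)[OF subsetD[OF sub2(1) l]] by (rule if_P)
    qed
    have s_vertex: "s (V l) = t (V l)" if l: "l \<in> {a..b + 2}" for l
    proof -
      have "r (V l) = t (V l)" if "l \<in> {k..q + 2}" using shared l that rt by blast
      from if_cong[OF refl this refl] show ?thesis
        unfolding s(2)[OF subsetD[OF sub2(2) l]] by (simp only: if_cancel)
    qed
    have s_t: "s x = t x" if "x \<in> support V a b" for x
      using splines_agree[OF s(1) t(1) sub(2) order_refl s_vertex that] .
    have "s x = c x" if x: "x \<in> nodes_in V P Q A" for x
    proof (cases "x \<in> support V k q")
      case True
      then show ?thesis using sr r(2) x by (simp add: nodes_in_def)
    next
      case False
      then have "x \<in> nodes_in V a b A" "x \<notin> {V j, V (j + 1)}"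
        using x supp jk by (auto simp: nodes_in_def)
      then show ?thesis using s_t[of x] t(2) by (simp add: d_def nodes_in_def)
    qed
    then show ?thesis using s(1) by blast
  qed
  moreover have "s = t" if s: "s \<in> splines V P Q" and t: "t \<in> splines V P Q"
    and eq: "\<forall>x\<in>nodes_in V P Q A. s x = t x" for s t
  proof -
    have on_core: "s x = t x" if "x \<in> support V k q" for x
      using poised_agree[OF core core_sub s sub(1) t sub(1) _ that] eq supp
      by (auto simp: nodes_in_def)
    have "s x = t x" if "x \<in> ?B" for x
      using that on_core jk eq supp by (auto simp: nodes_in_def)
    then have "s x = t x" if "x \<in> support V a b" for x
      using poised_agree[OF reduced B_sub s sub(2) t sub(2) _ that] by blast
    with on_core have "s x = t x" if "x \<in> support V P Q" for x using that supp by blast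
    moreover have "P \<le> Q" using st by (simp add: strip_def)
    ultimately show ?thesis using vertex_in_support by (intro splines_eqI[OF s t]) blast
  qed
  ultimately show ?thesis unfolding poised_iff by blast
qed

lemma predecessor:
  fixes p k :: nat
  assumes "p < k"
  obtains r where "k = r + 1" "p \<le> r"
  using that[of "k - 1"] assms by simp

lemma interval_cut: "p \<le> r \<Longrightarrow> r \<le> q \<Longrightarrow> {p..q} = {p..r} \<union> {r + 1..q::nat}"
  using ivl_disj_un_two(8)[of p r q]
  unfolding Suc_eq_plus1[symmetric] atLeastSucAtMost_greaterThanAtMost by (rule sym)

text \<open>The two outer parts are treated alike, except that cutting at \<open>r\<close> leaves the core on the right
  of the cut in the first case and on the left in the second.\<close>

lemma reduced_left:
  assumes ip: "interp_problem V P Q A" and po: "poised V P Q A"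
    and r: "P \<le> r" "r < q" "q \<le> Q"
    and core: "poised V (r + 1) q (nodes_in V (r + 1) q A)"
    and op: "A \<inter> open_segment (V (r + 1)) (V (r + 1 + 1)) = {}"
  shows "exact V P r (nodes_in V P r A \<union> {V (r + 1), V (r + 1 + 1)}) \<and>
    poised V P r (nodes_in V P r A \<union> {V (r + 1), V (r + 1 + 1)})" (is "exact V P r ?L \<and> _")
proof -
  have st: "strip V P Q" and fin: "finite A" using ip unfolding interp_problem_def by blast+
  have rQ: "r < Q" using r(2,3) by (rule less_le_trans)
  have po': "poised V P r ?L"
  proof (rule poised_reduced[OF ip po r(1) _ _ _ _ _ _ _ core])
    show "{P..r} \<subseteq> {P..Q}" using rQ by auto
    show "r + 1 \<le> q" using r(2) by simp
    show "{r + 1..q} \<subseteq> {P..Q}" using r(1,3) by auto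
    show "r + 1 \<in> {P..r + 1}" "r + 1 \<in> {r + 1..q + 1}" using r(1,2) by auto
    show "{i..i + 2} \<inter> {P..r + 2} \<subseteq> {r + 1, r + 1 + 1}" if "i \<in> {P..Q} - {P..r}" for i
      using that by auto
    have "support V (r + 1) q \<subseteq> support V (r + 1) Q"
      using r(3) by (intro support_mono) (simp add: atLeastatMost_subset_iff)
    then show "A \<inter> support V P r \<inter> support V (r + 1) q \<subseteq> {V (r + 1), V (r + 1 + 1)}"
      using support_Int_support[OF st r(1) rQ] op
      unfolding side_def closed_segment_eq_open by blast
  qed
  moreover have "interp_problem V P r ?L"
    unfolding interp_problem_def
  proof (intro conjI)
    show "strip V P r" using st order_refl r(1) less_imp_le[OF rQ] by (rule strip_mono)
    have "r + 1 \<in> {P..r + 2}" "r + 1 + 1 \<in> {P..r + 2}" using r(1) by auto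
    then show "?L \<subseteq> support V P r"
      using vertex_in_support[OF r(1), of _ V] unfolding nodes_in_def by blast
  qed (use fin in \<open>auto simp: nodes_in_def\<close>)
  ultimately show ?thesis using poised_imp_exact by blast
qed

lemma reduced_right:
  assumes ip: "interp_problem V P Q A" and po: "poised V P Q A"
    and r: "P \<le> k" "k \<le> r" "r < Q"
    and core: "poised V k r (nodes_in V k r A)"
    and op: "A \<inter> open_segment (V (r + 1)) (V (r + 1 + 1)) = {}"
  shows "exact V (r + 1) Q (nodes_in V (r + 1) Q A \<union> {V (r + 1), V (r + 1 + 1)}) \<and>
    poised V (r + 1) Q (nodes_in V (r + 1) Q A \<union> {V (r + 1), V (r + 1 + 1)})"
    (is "exact V (r + 1) Q ?R \<and> _")
proof -
  have st: "strip V P Q" and fin: "finite A" using ip unfolding interp_problem_def by blast+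
  have Pr: "P \<le> r" using r(1,2) by (rule order_trans)
  have rQ: "r + 1 \<le> Q" using r(3) by simp
  have po': "poised V (r + 1) Q ?R"
  proof (rule poised_reduced[OF ip po rQ _ r(2) _ _ _ _ _ core])
    show "{r + 1..Q} \<subseteq> {P..Q}" using Pr by auto
    show "{k..r} \<subseteq> {P..Q}" using r(1,3) by auto
    show "r + 1 \<in> {r + 1..Q + 1}" "r + 1 \<in> {k..r + 1}" using r(2,3) by auto
    show "{i..i + 2} \<inter> {r + 1..Q + 2} \<subseteq> {r + 1, r + 1 + 1}" if "i \<in> {P..Q} - {r + 1..Q}" for i
      using that by auto
    have "support V k r \<subseteq> support V P r"
      using r(1) by (intro support_mono) (simp add: atLeastatMost_subset_iff)
    then show "A \<inter> support V (r + 1) Q \<inter> support V k r \<subseteq> {V (r + 1), V (r + 1 + 1)}"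
      using support_Int_support[OF st Pr r(3)] op
      unfolding side_def closed_segment_eq_open by blast
  qed
  moreover have "interp_problem V (r + 1) Q ?R"
    unfolding interp_problem_def
  proof (intro conjI)
    show "strip V (r + 1) Q" using st le_SucI[OF Pr] rQ order_refl
      unfolding Suc_eq_plus1 by (rule strip_mono)
    have "r + 1 \<in> {r + 1..Q + 2}" "r + 1 + 1 \<in> {r + 1..Q + 2}" using r(3) by auto
    then show "?R \<subseteq> support V (r + 1) Q"
      using vertex_in_support[OF rQ, of _ V] unfolding nodes_in_def by blast
  qed (use fin in \<open>auto simp: nodes_in_def\<close>)
  ultimately show ?thesis using poised_imp_exact by blast
qed

lemma poised_iff_reduced:
  assumes ip: "interp_problem V P Q A" and kq: "P \<le> k" "k \<le> q" "q \<le> Q"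
    and core: "poised V k q (nodes_in V k q A)"
    and openL: "P < k \<Longrightarrow> A \<inter> open_segment (V k) (V (k + 1)) = {}"
    and openR: "q < Q \<Longrightarrow> A \<inter> open_segment (V (q + 1)) (V (q + 1 + 1)) = {}"
  shows "poised V P Q A \<longleftrightarrow>
    (P < k \<longrightarrow> exact V P (k - 1) (nodes_in V P (k - 1) A \<union> {V k, V (k + 1)}) \<and>
      poised V P (k - 1) (nodes_in V P (k - 1) A \<union> {V k, V (k + 1)})) \<and>
    (q < Q \<longrightarrow> exact V (q + 1) Q (nodes_in V (q + 1) Q A \<union> {V (q + 1), V (q + 1 + 1)}) \<and>
      poised V (q + 1) Q (nodes_in V (q + 1) Q A \<union> {V (q + 1), V (q + 1 + 1)}))"
    (is "_ \<longleftrightarrow> (_ \<longrightarrow> ?L) \<and> (_ \<longrightarrow> ?R)")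
proof
  assume po: "poised V P Q A"
  have ?L if "P < k"
  proof -
    obtain r where k: "k = r + 1" and r: "P \<le> r" using \<open>P < k\<close> by (rule predecessor)
    have rq: "r < q" using kq(2) unfolding k Suc_eq_plus1[symmetric] Suc_le_eq .
    show ?thesis
      using reduced_left[OF ip po r rq kq(3)] core openL[OF that]
      unfolding k add_diff_cancel_right' by blast
  qed
  moreover have ?R if "q < Q"
    using ip po kq(1,2) that core openR[OF that] by (rule reduced_right)
  ultimately show "(P < k \<longrightarrow> ?L) \<and> (q < Q \<longrightarrow> ?R)" by blast
next
  assume red: "(P < k \<longrightarrow> ?L) \<and> (q < Q \<longrightarrow> ?R)"
  have st: "strip V P Q" and A: "A \<subseteq> support V P Q" using ip unfolding interp_problem_def by blast+
  have Pq: "P \<le> q" using kq(1,2) by (rule order_trans)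
  \<comment> \<open>The core grows first to the left and then to the right.\<close>
  have left: "poised V P q (nodes_in V P q A)"
  proof (cases "P < k")
    case True
    then obtain r where k: "k = r + 1" and r: "P \<le> r" by (rule predecessor)
    have rq: "r \<le> q" using kq(2) unfolding k Suc_eq_plus1[symmetric] by (rule Suc_leD)
    show ?thesis
    proof (rule poised_glue[OF _ _ r kq(2) _ _ _ core])
      show "strip V P q" using st order_refl Pq kq(3) by (rule strip_mono)
      show "{P..q} = {k..q} \<union> {P..r}"
        unfolding k interval_cut[OF r rq] by (rule Un_commute)
      show "k \<in> {P..r + 1}" "k \<in> {k..q + 1}" using kq(1,2) k by simp_all
      show "{k..q + 2} \<inter> {P..r + 2} \<subseteq> {k, k + 1}" unfolding k by auto
      show "poised V P r (nodes_in V P r A \<union> {V k, V (k + 1)})"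
        using red True unfolding k add_diff_cancel_right' by blast
    qed
  next
    case False
    then have "P = k" using kq(1) by simp
    then show ?thesis using core by blast
  qed
  have "poised V P Q (nodes_in V P Q A)"
  proof (cases "q < Q")
    case True
    then have qQ: "q + 1 \<le> Q" by simp
    show ?thesis
    proof (rule poised_glue[OF st _ qQ Pq _ _ _ left])
      show "{P..Q} = {P..q} \<union> {q + 1..Q}" using Pq kq(3) by (rule interval_cut)
      show "q + 1 \<in> {q + 1..Q + 1}" "q + 1 \<in> {P..q + 1}" using Pq True by simp_all
      show "{P..q + 2} \<inter> {q + 1..Q + 2} \<subseteq> {q + 1, q + 1 + 1}" by auto
    qed (use red True in blast)
  next
    case False
    then have "q = Q" using kq(3) by simp
    then show ?thesis using left by blast
  qed
  moreover have "nodes_in V P Q A = A" using A unfolding nodes_in_def by blast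
  ultimately show "poised V P Q A" by simp
qed

section \<open>Basic subproblems\<close>

text \<open>Distinct triangles of a strip share at most a side, and these shared points lie on interior
  sides, which carry no node of a basic problem.  Hence its nodes are counted triangle by triangle,
  giving \<open>2 + m + 2\<close>.\<close>

lemma basic_B_imp_exact:
  assumes "basic_B V p q A m"
  shows "exact V p q A"
proof -
  have st: "strip V p q" and fin: "finite A" and A: "A \<subseteq> support V p q" and q: "q = p + m + 1"
    and cp: "card (A \<inter> triangle V p) = 2" and cq: "card (A \<inter> triangle V q) = 2"
    and ci: "\<And>i. i \<in> {p<..<q} \<Longrightarrow> card (A \<inter> triangle V i) = 1"
    and sides: "\<And>i. i \<in> {p..<q} \<Longrightarrow> A \<inter> side V (i + 1) = {}"
    using assms unfolding basic_B_def interp_problem_def by blast+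
  have pq: "p < q" unfolding q by simp
  have less: "(A \<inter> triangle V i) \<inter> (A \<inter> triangle V j) = {}"
    if ij: "i \<in> {p..q}" "j \<in> {p..q}" "i < j" for i j
  proof -
    have "i \<in> {p..<q}"
      using ij(1) less_le_trans[OF ij(3)] ij(2) unfolding atLeastAtMost_iff atLeastLessThan_iff
      by blast
    moreover have "x \<in> side V (i + 1)" if "x \<in> triangle V i" "x \<in> triangle V j" for x
      using triangle_Int_triangle[OF st ij that]
    proof cases
      case 2
      show ?thesis using endpoints_in_side(2)[of V "i + 1"] unfolding 2(2) by simp
    qed
    ultimately show ?thesis using sides by blast
  qed
  have disj: "(A \<inter> triangle V i) \<inter> (A \<inter> triangle V j) = {}"
    if "i \<in> {p..q}" "j \<in> {p..q}" "i \<noteq> j" for i j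
    using less[of i j] less[of j i] that by (metis Int_commute linorder_neq_iff)
  have "A = (\<Union>i\<in>{p..q}. A \<inter> triangle V i)" using A unfolding support_def by blast
  also have "card \<dots> = (\<Sum>i\<in>{p..q}. card (A \<inter> triangle V i))"
    using fin disj by (intro card_UN_disjoint) blast+
  also have "{p..q} = insert p (insert q {p<..<q})" using pq by auto
  also have "(\<Sum>i\<in>\<dots>. card (A \<inter> triangle V i)) =
      2 + (2 + (\<Sum>i\<in>{p<..<q}. card (A \<inter> triangle V i)))"
    using cp cq less_imp_neq[OF pq] by simp
  also have "(\<Sum>i\<in>{p<..<q}. card (A \<inter> triangle V i)) = (\<Sum>i\<in>{p<..<q}. 1)"
    using ci by (rule sum.cong[OF refl])
  also have "2 + (2 + (\<Sum>i\<in>{p<..<q}. 1)) = card {p..q} + 2" unfolding q by simp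
  finally show ?thesis unfolding exact_def .
qed

section \<open>Reduction of a problem with a basic subproblem\<close>

theorem corollary5p2:
  fixes V :: "nat \<Rightarrow> real^2" and A :: "(real^2) set" and n m k :: nat
  assumes "interp_problem V 1 n A" and "exact V 1 n A"
    and "m \<noteq> 1" and "1 \<le> k" and "k + m + 1 \<le> n"
    and "basic_B V k (k + m + 1) (nodes_in V k (k + m + 1) A) m"
  shows "(\<not> poised V k (k + m + 1) (nodes_in V k (k + m + 1) A) \<longrightarrow> \<not> poised V 1 n A) \<and>
    (poised V k (k + m + 1) (nodes_in V k (k + m + 1) A) \<longrightarrow>
     (1 < k \<longrightarrow> A \<inter> open_segment (V k) (V (k + 1)) = {}) \<longrightarrow>
     (k + m + 1 < n \<longrightarrow> A \<inter> open_segment (V (k + m + 2)) (V (k + m + 3)) = {}) \<longrightarrow>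
     (poised V 1 n A \<longleftrightarrow>
       (1 < k \<longrightarrow>
         exact V 1 (k - 1) (nodes_in V 1 (k - 1) A \<union> {V k, V (k + 1)}) \<and>
         poised V 1 (k - 1) (nodes_in V 1 (k - 1) A \<union> {V k, V (k + 1)})) \<and>
       (k + m + 1 < n \<longrightarrow>
         exact V (k + m + 2) n
           (nodes_in V (k + m + 2) n A \<union> {V (k + m + 2), V (k + m + 3)}) \<and>
         poised V (k + m + 2) n
           (nodes_in V (k + m + 2) n A \<union> {V (k + m + 2), V (k + m + 3)}))))"
proof -
  define q where "q = k + m + 1"
  have q: "k + m + 2 = q + 1" "k + m + 3 = q + 1 + 1" "k + m + 1 = q" by (simp_all add: q_def)
  have kq: "k \<le> q" by (simp add: q_def)
  have qn: "q \<le> n" using assms(5) unfolding q(3) .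
  have "exact V k q (nodes_in V k q A)" using assms(6) unfolding q(3) by (rule basic_B_imp_exact)
  with assms(1) have "poised V k q (nodes_in V k q A)" if "poised V 1 n A"
    using that assms(4) kq qn by (intro poised_exact_substrip)
  with poised_iff_reduced[OF assms(1,4) kq qn] show ?thesis unfolding q by blast
qed

end
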